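(* Let $\mathcal E$ be a category and $\mathcal F\subseteq\mathcal E$ a subcategory with the same objects, and assume $\mathcal F$ is a countable projective Fra\"iss\'e category. Let $g\in\mathcal E$. Then $g$ belongs to the domination closure $[\mathcal F]$ of $\mathcal F$ in $\mathcal E$ if and only if there exists an $\mathcal E$-iso-sequence $(g_i)$ for $\mathcal F$ with $g_0=g$.
   Context: Projective Fra\"iss\'e category: essentially countable category (objects countable up to isomorphism, countably many morphisms between any two objects) with joint projection (for objects $o_1,o_2$ there are $e_1,e_2$ with $\mathrm{codom}(e_i)=o_i$ and common domain) and projective amalgamation (for $e_1,e_2$ with common codomain there are $e_1',e_2'$ with $e_1\circ e_1'=e_2\circ e_2'$). $\mathcal F$ is dominating in a set $X$ of morphisms if $g\circ f\in X$ for all composable $f\in\mathcal F$, $g\in X$, and for each $g'\in X$ there is $g''\in X$ with $g'\circ g''\in\mathcal F$; $[\mathcal F]$ is the union of all $X\subseteq\mathcal E$ in which $\mathcal F$ is dominating. A sequence $(e_n)$ is neat if $\mathrm{dom}(e_n)=\mathrm{codom}(e_{n+1})$; a neat sequence in $\mathcal F$ is generic for $\mathcal F$ if every object $o$ is the codomain of some $e\in\mathcal F$ with $\mathrm{dom}(e)=\mathrm{dom}(e_n)$ for some $n$, and for every $n$ and $e\in\mathcal F$ with $\mathrm{codom}(e)=\mathrm{codom}(e_n)$ there are $m>n$, $e'\in\mathcal F$ with $e_n\circ\dots\circ e_m=e\circ e'$. An $\mathcal E$-iso-sequence for $\mathcal F$ is a neat sequence $(g_i)$ of morphisms of $\mathcal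 E$ such that both $(g_{2i}\circ g_{2i+1})_i$ and $(g_{2i+1}\circ g_{2i+2})_i$ are generic sequences for $\mathcal F$. *)

theory Defs
  imports Main "HOL-Library.Countable_Set"
begin

text \<open>
  Categories are given by explicit carriers of objects and of morphisms. \<open>Comp C g f\<close> is
  \<open>g \<circ> f\<close> (first \<open>f\<close>, then \<open>g\<close>); it is meaningful only if \<open>Dom C g = Cod C f\<close>.
\<close>

record ('o, 'm) category_data =
  Obj :: "'o set"
  Mor :: "'m set"
  Dom :: "'m \<Rightarrow> 'o"
  Cod :: "'m \<Rightarrow> 'o"
  Id :: "'o \<Rightarrow> 'm"
  Comp :: "'m \<Rightarrow> 'm \<Rightarrow> 'm"

locale category =
  fixes C :: "('o, 'm) category_data"
  assumes Dom_Obj: "f \<in> Mor C \<Longrightarrow> Dom C f \<in> Obj C"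
    and Cod_Obj: "f \<in> Mor C \<Longrightarrow> Cod C f \<in> Obj C"
    and Id_Mor: "a \<in> Obj C \<Longrightarrow> Id C a \<in> Mor C"
    and Dom_Id: "a \<in> Obj C \<Longrightarrow> Dom C (Id C a) = a"
    and Cod_Id: "a \<in> Obj C \<Longrightarrow> Cod C (Id C a) = a"
    and Comp_Mor: "\<lbrakk>f \<in> Mor C; g \<in> Mor C; Dom C g = Cod C f\<rbrakk> \<Longrightarrow> Comp C g f \<in> Mor C"
    and Dom_Comp: "\<lbrakk>f \<in> Mor C; g \<in> Mor C; Dom C g = Cod C f\<rbrakk> \<Longrightarrow> Dom C (Comp C g f) = Dom C f"
    and Cod_Comp: "\<lbrakk>f \<in> Mor C; g \<in> Mor C; Dom C g = Cod C f\<rbrakk> \<Longrightarrow> Cod C (Comp C g f) = Cod C g"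
    and Comp_Id_right: "f \<in> Mor C \<Longrightarrow> Comp C f (Id C (Dom C f)) = f"
    and Comp_Id_left: "f \<in> Mor C \<Longrightarrow> Comp C (Id C (Cod C f)) f = f"
    and Comp_assoc: "\<lbrakk>f \<in> Mor C; g \<in> Mor C; h \<in> Mor C; Dom C g = Cod C f; Dom C h = Cod C g\<rbrakk>
      \<Longrightarrow> Comp C (Comp C h g) f = Comp C h (Comp C g f)"

locale wide_subcategory = E: category E + F: category F
  for E F :: "('o, 'm) category_data" +
  assumes Obj_eq: "Obj F = Obj E"
    and Mor_subset: "Mor F \<subseteq> Mor E"
    and Dom_eq: "f \<in> Mor F \<Longrightarrow> Dom F f = Dom E f"
    and Cod_eq: "f \<in> Mor F \<Longrightarrow> Cod F f = Cod E f"
    and Id_eq: "a \<in> Obj F \<Longrightarrow> Id F a = Id E a"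
    and Comp_eq: "\<lbrakk>f \<in> Mor F; g \<in> Mor F; Dom F g = Cod F f\<rbrakk> \<Longrightarrow> Comp F g f = Comp E g f"

definition Hom :: "('o, 'm) category_data \<Rightarrow> 'o \<Rightarrow> 'o \<Rightarrow> 'm set" where
  "Hom C a b = {f \<in> Mor C. Dom C f = a \<and> Cod C f = b}"

definition isomorphic_objects :: "('o, 'm) category_data \<Rightarrow> 'o \<Rightarrow> 'o \<Rightarrow> bool" where
  "isomorphic_objects C a b \<longleftrightarrow>
    (\<exists>f \<in> Hom C a b. \<exists>g \<in> Hom C b a. Comp C g f = Id C a \<and> Comp C f g = Id C b)"

definition essentially_countable :: "('o, 'm) category_data \<Rightarrow> bool" where
  "essentially_countable C \<longleftrightarrow>
    (\<exists>S \<subseteq> Obj C. countable S \<and> (\<forall>a \<in> Obj C. \<exists>b \<in> S. isomorphic_objects C a b)) \<and>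
    (\<forall>a \<in> Obj C. \<forall>b \<in> Obj C. countable (Hom C a b))"

definition joint_projection :: "('o, 'm) category_data \<Rightarrow> bool" where
  "joint_projection C \<longleftrightarrow>
    (\<forall>a \<in> Obj C. \<forall>b \<in> Obj C. \<exists>e1 \<in> Mor C. \<exists>e2 \<in> Mor C.
      Cod C e1 = a \<and> Cod C e2 = b \<and> Dom C e1 = Dom C e2)"

definition projective_amalgamation :: "('o, 'm) category_data \<Rightarrow> bool" where
  "projective_amalgamation C \<longleftrightarrow>
    (\<forall>e1 \<in> Mor C. \<forall>e2 \<in> Mor C. Cod C e1 = Cod C e2 \<longrightarrow>
      (\<exists>e1' \<in> Mor C. \<exists>e2' \<in> Mor C. Dom C e1 = Cod C e1' \<and> Dom C e2 = Cod C e2' \<and>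
        Comp C e1 e1' = Comp C e2 e2'))"

locale projective_fraisse_category = category C
  for C :: "('o, 'm) category_data" +
  assumes ess_countable: "essentially_countable C"
    and joint_proj: "joint_projection C"
    and proj_amalg: "projective_amalgamation C"

definition dominating ::
    "('o, 'm) category_data \<Rightarrow> ('o, 'm) category_data \<Rightarrow> 'm set \<Rightarrow> bool" where
  "dominating E F X \<longleftrightarrow>
    (\<forall>f \<in> Mor F. \<forall>g \<in> X. Dom E g = Cod E f \<longrightarrow> Comp E g f \<in> X) \<and>
    (\<forall>g' \<in> X. \<exists>g'' \<in> X. Dom E g' = Cod E g'' \<and> Comp E g' g'' \<in> Mor F)"

definition domination_closure ::
    "('o, 'm) category_data \<Rightarrow> ('o, 'm) category_data \<Rightarrow> 'm set" where
  "domination_closure E F = \<Union>{X. X \<subseteq> Mor E \<and> dominating E F X}"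

definition neat :: "('o, 'm) category_data \<Rightarrow> (nat \<Rightarrow> 'm) \<Rightarrow> bool" where
  "neat C e \<longleftrightarrow> (\<forall>n. e n \<in> Mor C) \<and> (\<forall>n. Dom C (e n) = Cod C (e (Suc n)))"

text \<open>\<open>seq_comp C e n m\<close> is \<open>e\<^sub>n \<circ> e\<^sub>n\<^sub>+\<^sub>1 \<circ> \<dots> \<circ> e\<^sub>m\<close>, for \<open>n \<le> m\<close>.\<close>

definition seq_comp ::
    "('o, 'm) category_data \<Rightarrow> (nat \<Rightarrow> 'm) \<Rightarrow> nat \<Rightarrow> nat \<Rightarrow> 'm" where
  "seq_comp C e n m = foldl (Comp C) (e n) (map e [Suc n..<Suc m])"

definition generic_sequence :: "('o, 'm) category_data \<Rightarrow> (nat \<Rightarrow> 'm) \<Rightarrow> bool" where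
  "generic_sequence F e \<longleftrightarrow> neat F e \<and>
    (\<forall>a \<in> Obj F. \<exists>f \<in> Mor F. Cod F f = a \<and> (\<exists>n. Dom F f = Dom F (e n))) \<and>
    (\<forall>n. \<forall>f \<in> Mor F. Cod F f = Cod F (e n) \<longrightarrow>
      (\<exists>m > n. \<exists>f' \<in> Mor F. Dom F f = Cod F f' \<and> seq_comp F e n m = Comp F f f'))"

definition iso_sequence ::
    "('o, 'm) category_data \<Rightarrow> ('o, 'm) category_data \<Rightarrow> (nat \<Rightarrow> 'm) \<Rightarrow> bool" where
  "iso_sequence E F g \<longleftrightarrow> neat E g \<and>
    generic_sequence F (\<lambda>i. Comp E (g (2 * i)) (g (2 * i + 1))) \<and>
    generic_sequence F (\<lambda>i. Comp E (g (2 * i + 1)) (g (2 * i + 2)))"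

end

theory Submission
  imports Defs "HOL-Library.Nat_Bijection"
begin

text \<open>
  If \<open>(g\<^sub>i)\<close> is an iso-sequence, then \<open>\<F>\<close> is dominating in the set of all \<open>f \<circ> g\<^sub>i \<circ> f'\<close> with
  \<open>f, f' \<in> \<F>\<close>: by genericity \<open>g\<^sub>i\<^sub>+\<^sub>1 \<circ> \<dots> \<circ> g\<^sub>i\<^sub>+\<^sub>2\<^sub>k = f' \<circ> u\<close> with \<open>u \<in> \<F>\<close>, and multiplying
  \<open>f \<circ> g\<^sub>i \<circ> f'\<close> on the right by \<open>u \<circ> g\<^sub>i\<^sub>+\<^sub>2\<^sub>k\<^sub>+\<^sub>1\<close> gives a product of \<open>f\<close> and an even number of
  consecutive \<open>g\<^sub>j\<close>, which lies in \<open>\<F>\<close>.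

  Conversely, let \<open>\<F>\<close> be dominating in \<open>X\<close> and \<open>g\<^sub>i \<in> X\<close>. There is \<open>h \<in> X\<close> with
  \<open>g\<^sub>i \<circ> h \<in> \<F>\<close>, and \<open>g\<^sub>i\<^sub>+\<^sub>1 = h \<circ> a\<close> is admissible for every composable \<open>a \<in> \<F>\<close>. Choosing \<open>a\<close> by
  amalgamating \<open>g\<^sub>n \<circ> \<dots> \<circ> g\<^sub>i \<circ> h\<close> (with \<open>i - n\<close> even) and a prescribed \<open>t \<in> \<F>\<close>, one meets
  one genericity requirement at each step. By essential countability, countably many \<open>t\<close> suffice
  for each \<open>n\<close>. The requirement on objects follows by joint projection from the one on morphisms.
\<close>

section \<open>Composites along a sequence and its two sequences of pairs\<close>

lemma seq_comp_refl: "seq_comp C e n n = e n"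
  by (simp add: seq_comp_def)

lemma seq_comp_Suc:
  "n \<le> m \<Longrightarrow> seq_comp C e n (Suc m) = Comp C (seq_comp C e n m) (e (Suc m))"
  by (simp add: seq_comp_def)

lemma seq_comp_cong:
  assumes "n \<le> m" "\<And>j. n \<le> j \<Longrightarrow> j \<le> m \<Longrightarrow> e j = e' j"
  shows "seq_comp C e n m = seq_comp C e' n m"
proof -
  have "map e [Suc n..<Suc m] = map e' [Suc n..<Suc m]"
    using assms by (intro map_cong) auto
  moreover have "e n = e' n"
    using assms by simp
  ultimately show ?thesis
    by (simp only: seq_comp_def)
qed

text \<open>The bound \<open>b\<close> makes the notion usable for a sequence still under
  construction, fixed only up to index \<open>b\<close>; for a whole sequence it is assumed for
  every \<open>b\<close>.\<close>

definition pairwise_chain ::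
    "('o, 'm) category_data \<Rightarrow> ('o, 'm) category_data \<Rightarrow> (nat \<Rightarrow> 'm) \<Rightarrow> nat \<Rightarrow> bool" where
  "pairwise_chain E F g b \<longleftrightarrow> (\<forall>j\<le>b. g j \<in> Mor E) \<and>
    (\<forall>j<b. Dom E (g j) = Cod E (g (Suc j)) \<and> Comp E (g j) (g (Suc j)) \<in> Mor F)"

lemma pairwise_chain_mono: "pairwise_chain E F g b \<Longrightarrow> a \<le> b \<Longrightarrow> pairwise_chain E F g a"
  by (auto simp: pairwise_chain_def)

text \<open>The offsets \<open>p = 0\<close> and \<open>p = 1\<close> give the two sequences of an
  iso-sequence, so that both are treated by one argument.\<close>

definition pair_seq :: "('o, 'm) category_data \<Rightarrow> (nat \<Rightarrow> 'm) \<Rightarrow> nat \<Rightarrow> nat \<Rightarrow> 'm" where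
  "pair_seq E g p = (\<lambda>i. Comp E (g (2 * i + p)) (g (Suc (2 * i + p))))"

lemma iso_sequence_iff:
  "iso_sequence E F g \<longleftrightarrow>
    neat E g \<and> generic_sequence F (pair_seq E g 0) \<and> generic_sequence F (pair_seq E g 1)"
  by (simp add: iso_sequence_def pair_seq_def)

context wide_subcategory
begin

lemma Mor_E: "f \<in> Mor F \<Longrightarrow> f \<in> Mor E"
  using Mor_subset by blast

lemma Comp_Mor_F: "\<lbrakk>f \<in> Mor F; g \<in> Mor F; Dom E g = Cod E f\<rbrakk> \<Longrightarrow> Comp E g f \<in> Mor F"
  by (metis Comp_eq Dom_eq Cod_eq F.Comp_Mor)

lemma seq_comp_Mor:
  assumes "n \<le> m" "pairwise_chain E F g m"
  shows "seq_comp E g n m \<in> Mor E \<and> Dom E (seq_comp E g n m) = Dom E (g m) \<and>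
    Cod E (seq_comp E g n m) = Cod E (g n)"
  using assms
proof (induction m rule: dec_induct)
  case base
  then show ?case by (simp add: seq_comp_refl pairwise_chain_def)
next
  case (step m)
  have IH: "seq_comp E g n m \<in> Mor E" "Dom E (seq_comp E g n m) = Dom E (g m)"
    "Cod E (seq_comp E g n m) = Cod E (g n)"
    using step.IH pairwise_chain_mono[OF step.prems, of m] by auto
  have g: "g (Suc m) \<in> Mor E" "Dom E (g m) = Cod E (g (Suc m))"
    using step.prems by (auto simp: pairwise_chain_def)
  show ?case
    using IH g step.hyps by (simp add: seq_comp_Suc E.Comp_Mor E.Dom_Comp E.Cod_Comp)
qed

lemma seq_comp_Suc_Suc:
  assumes "n \<le> m" "pairwise_chain E F g (Suc (Suc m))"
  shows "seq_comp E g n (Suc (Suc m)) =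
    Comp E (seq_comp E g n m) (Comp E (g (Suc m)) (g (Suc (Suc m))))"
proof -
  have "seq_comp E g n m \<in> Mor E" "Dom E (seq_comp E g n m) = Dom E (g m)"
    using seq_comp_Mor[OF assms(1) pairwise_chain_mono[OF assms(2)]] by auto
  then show ?thesis
    using assms by (simp add: seq_comp_Suc pairwise_chain_def E.Comp_assoc)
qed

lemma seq_comp_Cons:
  assumes "n < m" "pairwise_chain E F g m"
  shows "seq_comp E g n m = Comp E (g n) (seq_comp E g (Suc n) m)"
  using Suc_leI[OF assms(1)] assms(2)
proof (induction m rule: dec_induct)
  case base
  then show ?case by (simp add: seq_comp_refl seq_comp_Suc)
next
  case (step m)
  have chain: "pairwise_chain E F g m"
    by (rule pairwise_chain_mono[OF step.prems]) simp
  show ?case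
    using step.IH[OF chain] step.hyps step.prems seq_comp_Mor[OF step.hyps(1) chain]
    by (simp add: seq_comp_Suc pairwise_chain_def E.Comp_assoc)
qed

text \<open>The \<open>2 * k + 2\<close> factors are bracketed in consecutive pairs, each of which
  lies in \<open>F\<close>.\<close>

lemma seq_comp_even_Mor_F:
  assumes "pairwise_chain E F g (Suc (n + 2 * k))"
  shows "seq_comp E g n (Suc (n + 2 * k)) \<in> Mor F"
  using assms
proof (induction k)
  case 0
  then show ?case by (simp add: seq_comp_refl seq_comp_Suc pairwise_chain_def)
next
  case (Suc k)
  let ?m = "Suc (n + 2 * k)"
  have chain: "pairwise_chain E F g (Suc (Suc ?m))"
    using Suc.prems by simp
  have "pairwise_chain E F g ?m"
    by (rule pairwise_chain_mono[OF chain]) simp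
  then have IH: "seq_comp E g n ?m \<in> Mor F" "Dom E (seq_comp E g n ?m) = Dom E (g ?m)"
    using Suc.IH seq_comp_Mor[of n ?m] by auto
  have g: "Comp E (g (Suc ?m)) (g (Suc (Suc ?m))) \<in> Mor F"
    "g (Suc ?m) \<in> Mor E" "g (Suc (Suc ?m)) \<in> Mor E"
    "Dom E (g ?m) = Cod E (g (Suc ?m))" "Dom E (g (Suc ?m)) = Cod E (g (Suc (Suc ?m)))"
    using chain by (auto simp: pairwise_chain_def)
  have "Comp E (seq_comp E g n ?m) (Comp E (g (Suc ?m)) (g (Suc (Suc ?m)))) \<in> Mor F"
    using IH g by (simp add: Comp_Mor_F E.Cod_Comp)
  then show ?case
    using seq_comp_Suc_Suc[OF _ chain, of n] by simp
qed

lemma neat_pair_seq: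
  assumes "\<And>b. pairwise_chain E F g b"
  shows "neat F (pair_seq E g p)"
    and "Cod F (pair_seq E g p i) = Cod E (g (2 * i + p))"
    and "Dom F (pair_seq E g p i) = Dom E (g (Suc (2 * i + p)))"
proof -
  have g: "g j \<in> Mor E" "Dom E (g j) = Cod E (g (Suc j))" "Comp E (g j) (g (Suc j)) \<in> Mor F" for j
    using assms[of "Suc j"] by (auto simp: pairwise_chain_def)
  show cod: "Cod F (pair_seq E g p i) = Cod E (g (2 * i + p))" for i
    using g by (simp add: pair_seq_def Cod_eq E.Cod_Comp)
  show dom: "Dom F (pair_seq E g p i) = Dom E (g (Suc (2 * i + p)))" for i
    using g by (simp add: pair_seq_def Dom_eq E.Dom_Comp)
  show "neat F (pair_seq E g p)"
    using g by (simp add: neat_def cod dom) (simp add: pair_seq_def)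
qed

text \<open>Associativity regroups the factors. Composition in \<open>F\<close> may be replaced by
  composition in \<open>E\<close> because the partial products have evenly many factors and so lie
  in \<open>F\<close>.\<close>

lemma seq_comp_pair_seq:
  assumes chain: "\<And>b. pairwise_chain E F g b" and "n \<le> m"
  shows "seq_comp F (pair_seq E g p) n m = seq_comp E g (2 * n + p) (Suc (2 * m + p))"
  using assms(2)
proof (induction m rule: dec_induct)
  case base
  then show ?case by (simp add: seq_comp_refl seq_comp_Suc pair_seq_def)
next
  case (step m)
  let ?M = "Suc (2 * m + p)"
  have s: "seq_comp E g (2 * n + p) ?M \<in> Mor F"
    using seq_comp_even_Mor_F[OF chain, of "2 * n + p" "m - n"] step.hyps
    by (simp add: algebra_simps)
  have s': "Dom E (seq_comp E g (2 * n + p) ?M) = Dom E (g ?M)"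
    using seq_comp_Mor[OF _ chain, of "2 * n + p" ?M] step.hyps by simp
  have e: "pair_seq E g p (Suc m) \<in> Mor F"
    using neat_pair_seq(1)[OF chain] by (simp add: neat_def)
  have d: "Dom E (g ?M) = Cod E (g (Suc ?M))"
    using chain[of "Suc ?M"] by (simp add: pairwise_chain_def)
  have "seq_comp F (pair_seq E g p) n (Suc m) =
      Comp F (seq_comp E g (2 * n + p) ?M) (pair_seq E g p (Suc m))"
    using step by (simp add: seq_comp_Suc)
  also have "\<dots> = Comp E (seq_comp E g (2 * n + p) ?M) (pair_seq E g p (Suc m))"
    using s s' e d neat_pair_seq(2)[OF chain, of p "Suc m"] by (intro Comp_eq) (simp_all add: Dom_eq)
  also have "\<dots> = seq_comp E g (2 * n + p) (Suc (2 * Suc m + p))"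
    using seq_comp_Suc_Suc[OF _ chain, of "2 * n + p" ?M] step.hyps by (simp add: pair_seq_def)
  finally show ?case .
qed

section \<open>From iso-sequences to the domination closure\<close>

text \<open>The parity of \<open>n\<close> decides which of the two generic sequences has a pair
  starting with \<open>g n\<close>.\<close>

lemma iso_sequence_factor:
  assumes iso: "iso_sequence E F g" and chain: "\<And>b. pairwise_chain E F g b"
    and f: "f \<in> Mor F" "Cod E f = Cod E (g n)"
  shows "\<exists>k. \<exists>f'\<in>Mor F. Dom E f = Cod E f' \<and> seq_comp E g n (Suc (n + 2 * k)) = Comp E f f'"
proof -
  define i p where "i = n div 2" and "p = n mod 2"
  have n: "n = 2 * i + p"
    by (simp add: i_def p_def)
  have "p = 0 \<or> p = 1"
    unfolding p_def by auto
  then have "generic_sequence F (pair_seq E g p)"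
    using iso by (auto simp: iso_sequence_iff)
  moreover have "Cod F f = Cod F (pair_seq E g p i)"
    using f n by (simp add: neat_pair_seq(2)[OF chain] Cod_eq)
  ultimately obtain m f' where m: "m > i" and f': "f' \<in> Mor F" "Dom F f = Cod F f'"
    "seq_comp F (pair_seq E g p) i m = Comp F f f'"
    using f(1) unfolding generic_sequence_def by blast
  have "Suc (n + 2 * (m - i)) = Suc (2 * m + p)"
    using m n by simp
  then have "seq_comp E g n (Suc (n + 2 * (m - i))) = Comp E f f'"
    using f'(3) seq_comp_pair_seq[OF chain, of i m p] m n Comp_eq[OF f'(1) f(1) f'(2)]
    by (metis less_imp_le)
  then show ?thesis
    using f' f Dom_eq Cod_eq by metis
qed

lemma iso_sequence_imp_domination_closure:
  assumes iso: "iso_sequence E F g"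
  shows "g 0 \<in> domination_closure E F"
proof -
  have gE: "g j \<in> Mor E" and gD: "Dom E (g j) = Cod E (g (Suc j))" for j
    using iso by (auto simp: iso_sequence_def neat_def)
  have "Comp E (g j) (g (Suc j)) \<in> Mor F" for j
  proof -
    have "pair_seq E g 0 (j div 2) \<in> Mor F" "pair_seq E g 1 (j div 2) \<in> Mor F"
      using iso by (auto simp: iso_sequence_iff generic_sequence_def neat_def)
    moreover have "j = 2 * (j div 2) \<or> j = 2 * (j div 2) + 1"
      by presburger
    ultimately show ?thesis
      unfolding pair_seq_def by (metis add.right_neutral)
  qed
  then have chain: "pairwise_chain E F g b" for b
    using gE gD by (simp add: pairwise_chain_def)
  \<comment> \<open>The right factor gives closure under composition with \<open>F\<close>; the left
    factor makes room for the complement \<open>y\<close> below, which begins with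
    \<open>u\<close>.\<close>
  define X where "X = {Comp E f (Comp E (g i) f') | f f' i. f \<in> Mor F \<and> f' \<in> Mor F \<and>
    Dom E f = Cod E (g i) \<and> Dom E (g i) = Cod E f'}"
  have XI: "Comp E f (Comp E (g i) f') \<in> X"
    if "f \<in> Mor F" "f' \<in> Mor F" "Dom E f = Cod E (g i)" "Dom E (g i) = Cod E f'" for f f' i
    using that unfolding X_def by blast
  have idF: "Id E a \<in> Mor F" "Dom E (Id E a) = a" "Cod E (Id E a) = a" if "a \<in> Obj E" for a
    using that F.Id_Mor[of a] Id_eq[of a] Obj_eq E.Dom_Id E.Cod_Id by auto
  have "X \<subseteq> Mor E"
    unfolding X_def by (auto intro!: E.Comp_Mor simp: Mor_E gE E.Cod_Comp)
  moreover have "g 0 \<in> X"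
    using XI[of "Id E (Cod E (g 0))" "Id E (Dom E (g 0))" 0]
      idF[OF E.Dom_Obj[OF gE[of 0]]] idF[OF E.Cod_Obj[OF gE[of 0]]]
      E.Comp_Id_right[OF gE[of 0]] E.Comp_Id_left[OF gE[of 0]]
    by simp
  moreover have "dominating E F X"
    unfolding dominating_def
  proof (intro conjI ballI impI)
    fix u x assume u: "u \<in> Mor F" and x: "x \<in> X" and d: "Dom E x = Cod E u"
    obtain f f' i where f: "f \<in> Mor F" "f' \<in> Mor F" "Dom E f = Cod E (g i)"
      "Dom E (g i) = Cod E f'" "x = Comp E f (Comp E (g i) f')"
      using x unfolding X_def by blast
    note E_mor = f(1,2)[THEN Mor_E] u[THEN Mor_E] gE[of i]
    have d': "Dom E f' = Cod E u"
      using d f E_mor by (simp add: E.Dom_Comp E.Cod_Comp E.Comp_Mor)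
    have "Comp E x u = Comp E f (Comp E (g i) (Comp E f' u))"
      using d' f E_mor by (simp add: E.Dom_Comp E.Cod_Comp E.Comp_Mor E.Comp_assoc)
    moreover have "Comp E f' u \<in> Mor F" "Cod E (Comp E f' u) = Cod E f'"
      using d' f u E_mor by (simp_all add: Comp_Mor_F E.Cod_Comp)
    ultimately show "Comp E x u \<in> X"
      using XI f(1,3,4) by simp
  next
    fix x assume x: "x \<in> X"
    obtain f f' i where f: "f \<in> Mor F" "f' \<in> Mor F" "Dom E f = Cod E (g i)"
      "Dom E (g i) = Cod E f'" "x = Comp E f (Comp E (g i) f')"
      using x unfolding X_def by blast
    obtain k u where u: "u \<in> Mor F" "Dom E f' = Cod E u"
      "seq_comp E g (Suc i) (Suc (Suc i + 2 * k)) = Comp E f' u"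
      using iso_sequence_factor[OF iso chain f(2), of "Suc i"] f(4) gD by auto
    let ?M = "Suc (Suc i + 2 * k)"
    note E_mor = f(1,2)[THEN Mor_E] u(1)[THEN Mor_E] gE
    have su: "Dom E (Comp E f' u) = Dom E (g ?M)"
      using seq_comp_Mor[OF _ chain, of "Suc i" ?M] u(3) by simp
    then have du: "Dom E u = Cod E (g (Suc ?M))"
      using gD u E_mor by (simp add: E.Dom_Comp)
    \<comment> \<open>As \<open>f' \<circ> u\<close> is the composite from \<open>Suc i\<close> to
      \<open>?M\<close>, the product \<open>x \<circ> y\<close> is \<open>f\<close> times the
      composite from \<open>i\<close> to \<open>Suc ?M\<close>, which has \<open>2 * k + 4\<close>
      factors.\<close>
    define y where "y = Comp E u (g (Suc ?M))"
    have y: "y \<in> Mor E" "Cod E y = Cod E u"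
      using du E_mor by (simp_all add: y_def E.Comp_Mor E.Cod_Comp)
    have "y = Comp E u (Comp E (g (Suc ?M)) (Id E (Dom E (g (Suc ?M)))))"
      by (simp only: y_def E.Comp_Id_right[OF gE])
    then have "y \<in> X"
      using XI[OF u(1) _ du] idF[OF E.Dom_Obj[OF gE[of "Suc ?M"]]] by simp
    moreover have "Dom E x = Cod E y"
      using f u y E_mor by (simp add: E.Dom_Comp E.Cod_Comp E.Comp_Mor)
    moreover have "Comp E x y \<in> Mor F"
    proof -
      have "Comp E x y = Comp E f (Comp E (g i) (Comp E f' y))"
        using f u y E_mor by (simp add: E.Dom_Comp E.Cod_Comp E.Comp_Mor E.Comp_assoc)
      also have "Comp E f' y = Comp E (Comp E f' u) (g (Suc ?M))"
        using u du E_mor by (simp add: y_def E.Comp_assoc)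
      also have "\<dots> = seq_comp E g (Suc i) (Suc ?M)"
        using u(3) by (simp add: seq_comp_Suc)
      also have "Comp E (g i) \<dots> = seq_comp E g i (Suc ?M)"
        by (rule seq_comp_Cons[OF _ chain, symmetric]) simp
      finally have "Comp E x y = Comp E f (seq_comp E g i (Suc ?M))" .
      moreover have "seq_comp E g i (Suc ?M) \<in> Mor F"
        using seq_comp_even_Mor_F[OF chain, of i "Suc k"] by simp
      moreover have "Cod E (seq_comp E g i (Suc ?M)) = Cod E (g i)"
        using seq_comp_Mor[OF _ chain, of i "Suc ?M"] by simp
      ultimately show ?thesis
        using Comp_Mor_F f by simp
    qed
    ultimately show "\<exists>y\<in>X. Dom E x = Cod E y \<and> Comp E x y \<in> Mor F"
      by blast
  qed
  ultimately show ?thesis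
    unfolding domination_closure_def by blast
qed

section \<open>From the domination closure to iso-sequences\<close>

text \<open>Every domain receives an isomorphism from an object of a countable set \<open>S\<close>,
  and only countably many arrows lead from \<open>S\<close> to \<open>a\<close>; \<open>t a\<close>
  enumerates them.\<close>

lemma countable_cofinal_morphisms:
  assumes "essentially_countable F"
  shows "\<exists>t :: 'o \<Rightarrow> nat \<Rightarrow> 'm. (\<forall>a\<in>Obj E. \<forall>k. t a k \<in> Mor F \<and> Cod E (t a k) = a) \<and>
    (\<forall>f\<in>Mor F. \<exists>k. \<exists>u\<in>Mor F. Dom E f = Cod E u \<and> Comp E f u = t (Cod E f) k)"
proof -
  obtain S where S: "S \<subseteq> Obj F" "countable S" "\<forall>a\<in>Obj F. \<exists>b\<in>S. isomorphic_objects F a b"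
    and hom: "\<forall>a\<in>Obj F. \<forall>b\<in>Obj F. countable (Hom F a b)"
    using assms unfolding essentially_countable_def by blast
  define T where "T = (\<lambda>a. \<Union>b\<in>S. Hom F b a)"
  have cofinal: "\<exists>u\<in>Mor F. Dom E f = Cod E u \<and> Comp E f u \<in> T (Cod E f)" if f: "f \<in> Mor F" for f
  proof -
    obtain b where b: "b \<in> S" "isomorphic_objects F (Dom F f) b"
      using S(3) F.Dom_Obj[OF f] by blast
    then obtain u where u: "u \<in> Hom F b (Dom F f)"
      unfolding isomorphic_objects_def by blast
    then have "Comp F f u \<in> Hom F b (Cod F f)"
      using f by (simp add: Hom_def F.Comp_Mor F.Dom_Comp F.Cod_Comp)
    then have "Comp F f u \<in> T (Cod F f)"
      using b(1) by (auto simp: T_def)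
    moreover have "u \<in> Mor F" "Dom F f = Cod F u"
      using u by (simp_all add: Hom_def)
    ultimately show ?thesis
      using f Comp_eq Cod_eq Dom_eq by metis
  qed
  have count: "countable (T a)" if "a \<in> Obj E" for a
    unfolding T_def
  proof (rule countable_UN[OF S(2)])
    fix b assume "b \<in> S"
    then show "countable (Hom F b a)"
      using that S(1) hom Obj_eq by blast
  qed
  \<comment> \<open>\<open>from_nat_into\<close> yields elements of the set only if it is nonempty;
    \<open>cofinal\<close> at the identity supplies one.\<close>
  have nonempty: "T a \<noteq> {}" if "a \<in> Obj E" for a
  proof -
    have "a \<in> Obj F"
      using that Obj_eq by simp
    then have "Id F a \<in> Mor F" "Cod E (Id F a) = a"
      using F.Id_Mor F.Cod_Id Cod_eq by metis+
    then show ?thesis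
      using cofinal[of "Id F a"] by auto
  qed
  let ?t = "\<lambda>a. from_nat_into (T a)"
  have "?t a k \<in> Mor F \<and> Cod E (?t a k) = a" if "a \<in> Obj E" for a k
  proof -
    have "?t a k \<in> T a"
      by (rule from_nat_into[OF nonempty[OF that]])
    then show ?thesis
      using Cod_eq unfolding T_def Hom_def by force
  qed
  moreover have "\<exists>k. \<exists>u\<in>Mor F. Dom E f = Cod E u \<and> Comp E f u = ?t (Cod E f) k"
    if f: "f \<in> Mor F" for f
  proof -
    obtain u where u: "u \<in> Mor F" "Dom E f = Cod E u" "Comp E f u \<in> T (Cod E f)"
      using cofinal[OF f] by blast
    obtain k where "?t (Cod E f) k = Comp E f u"
      using from_nat_into_surj[OF count[OF E.Cod_Obj[OF Mor_E[OF f]]] u(3)] by blast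
    with u show ?thesis
      by metis
  qed
  ultimately show ?thesis
    by (intro exI[of _ ?t]) simp
qed

text \<open>A composite that factors through \<open>f \<circ> u\<close> factors through
  \<open>f\<close>, so testing on the cofinal family \<open>t\<close> suffices.\<close>

lemma generic_pair_seq:
  assumes chain: "\<And>b. pairwise_chain E F g b"
    and jp: "joint_projection F"
    and cof: "\<forall>f\<in>Mor F. \<exists>k. \<exists>u\<in>Mor F. Dom E f = Cod E u \<and> Comp E f u = t (Cod E f) k"
    and factor: "\<And>n k. \<exists>m\<ge>n. \<exists>f'\<in>Mor F. Dom E (t (Cod E (g (2 * n + p))) k) = Cod E f' \<and>
      seq_comp E g (2 * n + p) (Suc (2 * m + p)) = Comp E (t (Cod E (g (2 * n + p))) k) f'"
  shows "generic_sequence F (pair_seq E g p)"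
proof -
  note neat = neat_pair_seq[OF chain, where p = p]
  have mor: "\<exists>m>n. \<exists>f'\<in>Mor F. Dom F f = Cod F f' \<and> seq_comp F (pair_seq E g p) n m = Comp F f f'"
    if f: "f \<in> Mor F" and c: "Cod F f = Cod F (pair_seq E g p n)" for n f
  proof -
    have c': "Cod E f = Cod E (g (2 * n + p))"
      using c f neat by (simp add: Cod_eq)
    obtain k u where u: "u \<in> Mor F" "Dom E f = Cod E u" "Comp E f u = t (Cod E f) k"
      using cof f by blast
    obtain m f' where m: "m \<ge> n" and f': "f' \<in> Mor F" "Dom E (Comp E f u) = Cod E f'"
      "seq_comp E g (2 * n + p) (Suc (2 * m + p)) = Comp E (Comp E f u) f'"
      using factor[of n k] u(3) c' by auto
    \<comment> \<open>\<open>factor\<close> allows \<open>m = n\<close>, while genericity asks for a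
      strictly larger index; appending the next pair \<open>?e\<close> gains one.\<close>
    let ?e = "pair_seq E g p (Suc m)"
    have e: "?e \<in> Mor F" "Cod E ?e = Dom E (g (Suc (2 * m + p)))"
      using neat(1) neat(2)[of "Suc m"] chain[of "Suc (Suc (2 * m + p))"]
      by (auto simp: neat_def Cod_eq pairwise_chain_def)
    note E_mor = f[THEN Mor_E] u(1)[THEN Mor_E] f'(1)[THEN Mor_E] e(1)[THEN Mor_E]
    have df': "Dom E u = Cod E f'"
      using f'(2) u(2) E_mor by (simp add: E.Dom_Comp)
    have "Dom E (Comp E (Comp E f u) f') = Dom E (g (Suc (2 * m + p)))"
      using seq_comp_Mor[OF _ chain, of "2 * n + p" "Suc (2 * m + p)"] m f'(3) by simp
    then have de: "Dom E f' = Cod E ?e"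
      using e u(2) df' E_mor by (simp add: E.Dom_Comp E.Cod_Comp E.Comp_Mor)
    let ?w = "Comp E u (Comp E f' ?e)"
    have w: "?w \<in> Mor F" "Cod E ?w = Dom E f"
      using u(1,2) f'(1) df' de e E_mor by (simp_all add: Comp_Mor_F E.Cod_Comp E.Comp_Mor)
    have sF: "seq_comp F (pair_seq E g p) n m = Comp E (Comp E f u) f'"
      using seq_comp_pair_seq[OF chain m] f'(3) by simp
    have "Comp E (Comp E f u) f' \<in> Mor F" "Dom E (Comp E (Comp E f u) f') = Cod E ?e"
      using f u(1,2) f'(1) df' de E_mor by (simp_all add: Comp_Mor_F E.Dom_Comp E.Comp_Mor)
    then have "seq_comp F (pair_seq E g p) n (Suc m) = Comp E (Comp E (Comp E f u) f') ?e"
      using sF m e by (simp add: seq_comp_Suc Comp_eq Dom_eq Cod_eq)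
    also have "\<dots> = Comp E f ?w"
      using u(1,2) df' de E_mor by (simp add: E.Comp_assoc E.Comp_Mor E.Dom_Comp E.Cod_Comp)
    also have "\<dots> = Comp F f ?w"
      using w f by (simp add: Comp_eq Dom_eq Cod_eq)
    finally show ?thesis
      using m w f by (intro exI[of _ "Suc m"] conjI bexI[of _ ?w]) (auto simp: Dom_eq Cod_eq)
  qed
  have "\<exists>f\<in>Mor F. Cod F f = a \<and> (\<exists>n. Dom F f = Dom F (pair_seq E g p n))" if a: "a \<in> Obj F" for a
  proof -
    let ?e = "pair_seq E g p"
    have e0: "?e n \<in> Mor F" for n
      using neat(1) by (simp add: neat_def)
    \<comment> \<open>Factoring a composite through \<open>f1\<close> makes the domain of
      \<open>f'\<close> a domain of the sequence; \<open>f2 \<circ> f'\<close> then leads from there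
      to \<open>a\<close>.\<close>
    obtain f1 f2 where f12: "f1 \<in> Mor F" "f2 \<in> Mor F" "Cod F f1 = Cod F (?e 0)" "Cod F f2 = a"
      "Dom F f1 = Dom F f2"
      using jp a F.Cod_Obj[OF e0[of 0]] unfolding joint_projection_def by metis
    obtain m f' where m: "f' \<in> Mor F" "Dom F f1 = Cod F f'" "seq_comp F ?e 0 m = Comp F f1 f'"
      using mor[OF f12(1,3)] by blast
    have "Comp F f1 f' \<in> Mor F"
      using m f12 by (simp add: F.Comp_Mor)
    then have "Dom F (Comp F f1 f') = Dom F (?e m)"
      using seq_comp_pair_seq[OF chain, of 0 m p] m(3) neat(3)[of m]
        seq_comp_Mor[OF _ chain, of p "Suc (2 * m + p)"] by (simp add: Dom_eq)
    then have "Dom F (Comp F f2 f') = Dom F (?e m)"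
      using m f12 by (simp add: F.Dom_Comp)
    then show ?thesis
      using m f12 by (intro bexI[of _ "Comp F f2 f'"]) (auto simp: F.Cod_Comp F.Comp_Mor)
  qed
  then show ?thesis
    using mor neat(1) unfolding generic_sequence_def by blast
qed

lemma domination_closure_imp_iso_sequence:
  assumes fraisse: "projective_fraisse_category F"
    and g: "g \<in> domination_closure E F"
  shows "\<exists>gs. iso_sequence E F gs \<and> gs 0 = g"
proof -
  interpret PF: projective_fraisse_category F by (rule fraisse)
  obtain X where X: "X \<subseteq> Mor E" "dominating E F X" "g \<in> X"
    using g unfolding domination_closure_def by blast
  obtain t :: "'o \<Rightarrow> nat \<Rightarrow> 'm" where
    t: "\<forall>a\<in>Obj E. \<forall>k. t a k \<in> Mor F \<and> Cod E (t a k) = a"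
    and cof: "\<forall>f\<in>Mor F. \<exists>k. \<exists>u\<in>Mor F. Dom E f = Cod E u \<and> Comp E f u = t (Cod E f) k"
    using countable_cofinal_morphisms[OF PF.ess_countable] by blast
  \<comment> \<open>The choice of \<open>g\<^sub>i\<^sub>+\<^sub>1\<close> handles the task \<open>task i\<close>: factoring \<open>g\<^sub>n \<circ> \<dots> \<circ> g\<^sub>i\<^sub>+\<^sub>1\<close>, where
    \<open>n = start i\<close>, through the morphism number \<open>snd (task i)\<close> into the codomain of \<open>g\<^sub>n\<close>.
    Even and odd \<open>i\<close> serve the two sequences of pairs.\<close>
  define task where "task = (\<lambda>i::nat. prod_decode (i div 2))"
  define start where "start = (\<lambda>i. 2 * fst (task i) + i mod 2)"
  have start_le: "start i \<le> i" and start_even: "\<exists>l. i = start i + 2 * l" for i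
  proof -
    \<comment> \<open>\<open>prod_encode\<close> bounds its first argument, so a task concerns only
      terms already chosen.\<close>
    have "fst (task i) \<le> i div 2"
      using le_prod_encode_1[of "fst (task i)" "snd (task i)"] by (simp add: task_def)
    moreover have "i = 2 * (i div 2) + i mod 2"
      by simp
    ultimately show "start i \<le> i" "\<exists>l. i = start i + 2 * l"
      unfolding start_def
      by (linarith, intro exI[of _ "i div 2 - fst (task i)"]) linarith
  qed
  define target where
    "target = (\<lambda>gs i. t (Cod E (gs (start i))) (snd (task i)))"
  define step where "step = (\<lambda>gs i r. r \<in> X \<and> Dom E (gs i) = Cod E r \<and> Comp E (gs i) r \<in> Mor F \<and>
    (\<exists>f'\<in>Mor F. Dom E (target gs i) = Cod E f' \<and>
      Comp E (seq_comp E gs (start i) i) r = Comp E (target gs i) f'))"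
  \<comment> \<open>The condition on term \<open>Suc i\<close> refers only to terms up to
    \<open>i\<close>, as \<open>dependent_wf_choice\<close> requires.\<close>
  define P where "P = (\<lambda>gs n r. case n of 0 \<Rightarrow> r = g | Suc i \<Rightarrow> step gs i r)"
  have X_comp: "Comp E h a \<in> X" if "h \<in> X" "a \<in> Mor F" "Dom E h = Cod E a" for h a
    using X(2) that unfolding dominating_def by blast
  have ex_step: "\<exists>r. step gs i r" if gs: "gs i \<in> X" and chain: "pairwise_chain E F gs i" for gs i
  proof -
    let ?s = "seq_comp E gs (start i) i"
    obtain h where h: "h \<in> X" "Dom E (gs i) = Cod E h" "Comp E (gs i) h \<in> Mor F"
      using X(2) gs unfolding dominating_def by blast
    have hE: "h \<in> Mor E" and gE: "gs i \<in> Mor E"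
      using X(1) h gs by auto
    have s: "?s \<in> Mor E" "Dom E ?s = Dom E (gs i)" "Cod E ?s = Cod E (gs (start i))"
      using seq_comp_Mor[OF start_le chain] by auto
    have sh: "Comp E ?s h \<in> Mor F"
    proof -
      \<comment> \<open>With \<open>h\<close> placed provisionally at \<open>Suc i\<close>,
        \<open>?s \<circ> h\<close> becomes a composite of evenly many terms of a chain.\<close>
      let ?gs = "gs(Suc i := h)"
      obtain l where l: "i = start i + 2 * l"
        using start_even by blast
      have chain': "pairwise_chain E F ?gs (Suc i)"
        using chain h hE by (auto simp: pairwise_chain_def less_Suc_eq le_Suc_eq)
      have "seq_comp E ?gs (start i) i = ?s"
        by (intro seq_comp_cong start_le) simp
      then have "Comp E ?s h = seq_comp E ?gs (start i) (Suc i)"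
        using seq_comp_Suc[OF start_le, of E ?gs i] by simp
      also have "\<dots> \<in> Mor F"
        using seq_comp_even_Mor_F[of ?gs "start i" l] chain' l by metis
      finally show ?thesis .
    qed
    have "Cod E (gs (start i)) \<in> Obj E"
      using s E.Cod_Obj by metis
    then have tg: "target gs i \<in> Mor F" "Cod E (target gs i) = Cod E (gs (start i))"
      using t by (auto simp: target_def)
    have "Cod F (Comp E ?s h) = Cod F (target gs i)"
      using sh tg s h hE by (simp add: Cod_eq E.Cod_Comp)
    \<comment> \<open>Amalgamation in \<open>F\<close> meets the task, and precomposing
      \<open>h\<close> with \<open>a\<close> keeps it in \<open>X\<close> and its product with
      \<open>gs i\<close> in \<open>F\<close>.\<close>
    then obtain a f' where a: "a \<in> Mor F" "f' \<in> Mor F" "Dom F (Comp E ?s h) = Cod F a"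
      "Dom F (target gs i) = Cod F f'" "Comp F (Comp E ?s h) a = Comp F (target gs i) f'"
      using PF.proj_amalg sh tg(1) unfolding projective_amalgamation_def by meson
    have ha: "Dom E h = Cod E a"
      using a(1,3) sh s h hE by (simp add: Cod_eq Dom_eq E.Dom_Comp)
    have "Comp E (gs i) (Comp E h a) = Comp E (Comp E (gs i) h) a"
      using h ha hE gE Mor_E[OF a(1)] by (simp add: E.Comp_assoc)
    moreover have "Comp E (Comp E (gs i) h) a \<in> Mor F"
      using h ha hE gE a(1) by (simp add: Comp_Mor_F E.Dom_Comp)
    moreover have "Comp E ?s (Comp E h a) = Comp E (target gs i) f'"
      using a sh tg h ha hE s Mor_E[OF a(1)] Comp_eq[OF a(1) sh a(3)] Comp_eq[OF a(2) tg(1) a(4)]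
      by (simp add: E.Comp_assoc)
    moreover have "Dom E (target gs i) = Cod E f'"
      using a tg by (simp add: Dom_eq Cod_eq)
    moreover have "Cod E (Comp E h a) = Cod E h"
      using ha hE Mor_E[OF a(1)] by (simp add: E.Cod_Comp)
    ultimately have "step gs i (Comp E h a)"
      unfolding step_def using X_comp[OF h(1) a(1) ha] h(2) a(2) by auto
    then show ?thesis ..
  qed
  have inX: "gs n \<in> X" if "P gs n (gs n)" for gs n
    using that X(3) by (cases n) (auto simp: P_def step_def)
  have chainP: "pairwise_chain E F gs b" if "\<And>n. n \<le> b \<Longrightarrow> P gs n (gs n)" for gs b
    unfolding pairwise_chain_def
  proof (intro conjI allI impI)
    show "gs j \<in> Mor E" if "j \<le> b" for j
      using inX \<open>\<And>n. n \<le> b \<Longrightarrow> P gs n (gs n)\<close> X(1) that by blast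
    show "Dom E (gs j) = Cod E (gs (Suc j))" "Comp E (gs j) (gs (Suc j)) \<in> Mor F" if "j < b" for j
      using \<open>\<And>n. n \<le> b \<Longrightarrow> P gs n (gs n)\<close>[of "Suc j"] that by (auto simp: P_def step_def)
  qed
  have "\<exists>gs. \<forall>n. P gs n (gs n)"
  proof (rule dependent_wf_choice[OF wf_less_than])
    fix f f' :: "nat \<Rightarrow> 'm" and n r
    assume eq: "\<And>z. (z, n) \<in> less_than \<Longrightarrow> f z = f' z"
    show "P f n r = P f' n r"
    proof (cases n)
      case (Suc i)
      have "f j = f' j" if "j \<le> i" for j
        using eq that Suc by simp
      moreover from this have "seq_comp E f (start i) i = seq_comp E f' (start i) i"
        by (intro seq_comp_cong start_le) simp
      ultimately show ?thesis
        using Suc start_le[of i] by (simp add: P_def step_def target_def)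
    qed (simp add: P_def)
  next
    fix n and gs :: "nat \<Rightarrow> 'm"
    assume IH: "\<And>m. (m, n) \<in> less_than \<Longrightarrow> P gs m (gs m)"
    show "\<exists>r. P gs n r"
    proof (cases n)
      case (Suc i)
      then have "P gs m (gs m)" if "m \<le> i" for m
        using IH that by simp
      then show ?thesis
        using ex_step[of gs i] inX chainP Suc by (simp add: P_def)
    qed (simp add: P_def)
  qed
  then obtain gs where gs: "\<And>n. P gs n (gs n)" by blast
  have chain: "pairwise_chain E F gs b" for b
    using chainP gs by blast
  have generic: "generic_sequence F (pair_seq E gs p)" if p: "p < 2" for p
  proof (rule generic_pair_seq[OF chain PF.joint_proj cof])
    fix n k
    \<comment> \<open>Task \<open>(n, k)\<close> for offset \<open>p\<close> is met in choosing term
      \<open>Suc ?i\<close>. This index is \<open>Suc (2 * ?m + p)\<close>, hence \<open>?m\<close>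
      is the witness for \<open>m\<close>.\<close>
    let ?m = "prod_encode (n, k)"
    let ?i = "2 * ?m + p"
    have "?i div 2 = ?m" "?i mod 2 = p"
      using p by auto
    then have "task ?i = (n, k)" "start ?i = 2 * n + p"
      by (simp_all add: task_def start_def)
    moreover have "step gs ?i (gs (Suc ?i))"
      using gs[of "Suc ?i"] by (simp add: P_def)
    ultimately have "\<exists>f'\<in>Mor F. Dom E (t (Cod E (gs (2 * n + p))) k) = Cod E f' \<and>
        Comp E (seq_comp E gs (2 * n + p) ?i) (gs (Suc ?i)) =
        Comp E (t (Cod E (gs (2 * n + p))) k) f'"
      by (simp add: step_def target_def)
    moreover have "n \<le> ?m"
      by (rule le_prod_encode_1)
    moreover from this have "seq_comp E gs (2 * n + p) (Suc ?i) =
        Comp E (seq_comp E gs (2 * n + p) ?i) (gs (Suc ?i))"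
      by (intro seq_comp_Suc) simp
    ultimately show "\<exists>m\<ge>n. \<exists>f'\<in>Mor F. Dom E (t (Cod E (gs (2 * n + p))) k) = Cod E f' \<and>
        seq_comp E gs (2 * n + p) (Suc (2 * m + p)) = Comp E (t (Cod E (gs (2 * n + p))) k) f'"
      by metis
  qed
  have "neat E gs"
    unfolding neat_def
  proof (intro conjI allI)
    fix n
    show "gs n \<in> Mor E" "Dom E (gs n) = Cod E (gs (Suc n))"
      using chain[of "Suc n"] by (auto simp: pairwise_chain_def)
  qed
  moreover have "gs 0 = g"
    using gs[of 0] by (simp add: P_def)
  ultimately show ?thesis
    using generic[of 0] generic[of 1] by (auto simp: iso_sequence_iff)
qed

end

theorem theorem4p7:
  fixes E F :: "('o, 'm) category_data" and g :: 'm
  assumes "category E"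
    and "wide_subcategory E F"
    and "projective_fraisse_category F"
    and "g \<in> Mor E"
  shows "g \<in> domination_closure E F \<longleftrightarrow> (\<exists>gs. iso_sequence E F gs \<and> gs 0 = g)"
  using wide_subcategory.domination_closure_imp_iso_sequence[OF assms(2,3), of g]
    wide_subcategory.iso_sequence_imp_domination_closure[OF assms(2)]
  by auto

end
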